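(* Let $\mathbb{K}$ be an algebraically closed field of characteristic $0$, and let $X \subset \mathbb{P}^N$ be a smooth, irreducible, non-degenerate projective variety of dimension $n$ over $\mathbb{K}$. Let $g$ be the generic $X$-rank. If $g > 2$ and the secant variety $\sigma_{g-1}(X)$ is a hypersurface in $\mathbb{P}^N$, then $$r_{\max} \leq r_{\max,g-1} + 1,$$ where $r_{\max}$ is the maximum of the $X$-ranks $r_X(P)$ over all $P \in \mathbb{P}^N$, and $r_{\max,g-1}$ is the maximum of the $X$-ranks $r_X(P)$ over all $P \in \sigma_{g-1}(X)$.
   Context: A projective variety $X \subset \mathbb{P}^N$ is non-degenerate if it is not contained in any hyperplane of $\mathbb{P}^N$. For a point $P \in \mathbb{P}^N$, the $X$-rank $r_X(P)$ is the least number of points of $X$ whose linear span contains $P$. For $s \geq 1$, let $\sigma_s^0(X)$ denote the set of points of $\mathbb{P}^N$ of $X$-rank at most $s$; the $s$-th secant variety $\sigma_s(X)$ is the Zariski closure of $\sigma_s^0(X)$ in $\mathbb{P}^N$. The generic $X$-rank $g$ is the least integer such that $\sigma_g(X) = \mathbb{P}^N$. *)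

theory Defs
  imports
    "HOL-Analysis.Analysis"
    "HOL-Computational_Algebra.Polynomial"
    "HOL-Library.Poly_Mapping"
    "HOL-Library.Extended_Nat"
begin

section \<open>Polynomials in the coordinates of a vector\<close>

text \<open>The variables are indexed by \<open>'n\<close>; a monomial is its exponent vector.\<close>

type_synonym ('a, 'n) mpoly = "('n \<Rightarrow>\<^sub>0 nat) \<Rightarrow>\<^sub>0 'a"

definition mpoly_eval :: "'a::field ^ 'n::finite \<Rightarrow> ('a, 'n) mpoly \<Rightarrow> 'a" where
  "mpoly_eval v f =
     (\<Sum>m\<in>Poly_Mapping.keys f.
        Poly_Mapping.lookup f m * (\<Prod>i\<in>UNIV. (v $ i) ^ Poly_Mapping.lookup m i))"

definition mpoly_pderiv :: "'n::finite \<Rightarrow> ('a::field, 'n) mpoly \<Rightarrow> ('a, 'n) mpoly" where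
  "mpoly_pderiv i f =
     (\<Sum>m\<in>Poly_Mapping.keys f.
        Poly_Mapping.single (m - Poly_Mapping.single i 1)
          (of_nat (Poly_Mapping.lookup m i) * Poly_Mapping.lookup f m))"

definition homogeneous :: "nat \<Rightarrow> ('a::field, 'n::finite) mpoly \<Rightarrow> bool" where
  "homogeneous d f \<longleftrightarrow>
     (\<forall>m\<in>Poly_Mapping.keys f. (\<Sum>i\<in>UNIV. Poly_Mapping.lookup m i) = d)"

section \<open>Projective space and its Zariski topology\<close>

text \<open>
  With \<open>CARD('n) = N + 1\<close>, this is \<open>\<bbbP>\<^sup>N\<close>: its points are the lines through the
  origin of \<open>'a ^ 'n\<close>.
\<close>

definition proj_space :: "('a::field ^ 'n::finite) set set" where
  "proj_space = {vec.span {v} | v. v \<noteq> 0}"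

definition proj_zeros :: "('a::field, 'n::finite) mpoly set \<Rightarrow> ('a ^ 'n) set set" where
  "proj_zeros F = {P \<in> proj_space. \<forall>f\<in>F. \<forall>v\<in>P. mpoly_eval v f = 0}"

definition zariski :: "('a::field ^ 'n::finite) set topology" where
  "zariski = topology (\<lambda>U. \<exists>F. (\<forall>f\<in>F. \<exists>d. homogeneous d f) \<and> U = proj_space - proj_zeros F)"

text \<open>That this is a topology, with the expected closed sets, needs a few facts on evaluation.\<close>

lemma mpoly_eval_zero [simp]: "mpoly_eval v 0 = 0"
  by (simp add: mpoly_eval_def)

lemma mpoly_eval_add: "mpoly_eval v (f + g) = mpoly_eval v f + mpoly_eval v g"
  unfolding mpoly_eval_def
  by (rule setsum_keys_plus_distrib) (simp_all add: algebra_simps)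

lemma mpoly_eval_single:
  "mpoly_eval v (Poly_Mapping.single m c) = c * (\<Prod>i\<in>UNIV. (v $ i) ^ Poly_Mapping.lookup m i)"
  by (cases "c = 0") (simp_all add: mpoly_eval_def)

lemma mpoly_add_single_induct [case_names zero add]:
  fixes f :: "('a::field, 'n::finite) mpoly"
  assumes "P 0" and "\<And>m c f. P f \<Longrightarrow> P (Poly_Mapping.single m c + f)"
  shows "P f"
proof (induction f rule: update_induct)
  case const
  show ?case by (fact assms(1))
next
  case (update f a b)
  have "Poly_Mapping.update a b f = Poly_Mapping.single a b + f"
    using update.hyps
    by (intro poly_mapping_eqI)
      (auto simp: lookup_update lookup_add lookup_single when_def in_keys_iff)
  with update show ?case by (simp add: assms(2))
qed

lemma mpoly_eval_mult: "mpoly_eval v (f * g) = mpoly_eval v f * mpoly_eval v g"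
proof -
  have *: "mpoly_eval v (Poly_Mapping.single m c * g)
      = mpoly_eval v (Poly_Mapping.single m c) * mpoly_eval v g" for m c
    by (induction g rule: mpoly_add_single_induct)
      (simp_all add: distrib_left mpoly_eval_add mult_single mpoly_eval_single lookup_add
        power_add prod.distrib)
  show ?thesis
    by (induction f rule: mpoly_add_single_induct)
      (simp_all add: distrib_right mpoly_eval_add *)
qed

lemma mpoly_eval_scale:
  assumes "homogeneous d f"
  shows "mpoly_eval (c *s v) f = c ^ d * mpoly_eval v f"
proof -
  have "(\<Prod>i\<in>UNIV. ((c *s v) $ i) ^ Poly_Mapping.lookup m i)
      = c ^ d * (\<Prod>i\<in>UNIV. (v $ i) ^ Poly_Mapping.lookup m i)"
    if "m \<in> Poly_Mapping.keys f" for m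
    using assms that
    by (simp add: homogeneous_def power_mult_distrib prod.distrib flip: power_sum)
  then show ?thesis
    unfolding mpoly_eval_def sum_distrib_left by (intro sum.cong) simp_all
qed

lemma homogeneous_mult:
  assumes "homogeneous d f" and "homogeneous e g"
  shows "homogeneous (d + e) (f * g)"
  unfolding homogeneous_def
proof
  fix m assume "m \<in> Poly_Mapping.keys (f * g)"
  then obtain a b where "m = a + b" "a \<in> Poly_Mapping.keys f" "b \<in> Poly_Mapping.keys g"
    using keys_mult by blast
  with assms show "(\<Sum>i\<in>UNIV. Poly_Mapping.lookup m i) = d + e"
    by (simp add: homogeneous_def lookup_add sum.distrib)
qed

lemma in_proj_zeros_span_iff:
  fixes v :: "'a::field ^ 'n::finite"
  assumes "v \<noteq> 0" and "\<forall>f\<in>F. \<exists>d. homogeneous d f"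
  shows "vec.span {v} \<in> proj_zeros F \<longleftrightarrow> (\<forall>f\<in>F. mpoly_eval v f = 0)"
proof -
  have "vec.span {v} \<in> proj_space"
    using assms(1) by (auto simp: proj_space_def)
  moreover have "mpoly_eval w f = 0"
    if "f \<in> F" "mpoly_eval v f = 0" "w \<in> vec.span {v}" for f w
    using assms(2) that by (auto simp: vec.span_singleton mpoly_eval_scale)
  ultimately show ?thesis
    using vec.span_base[OF singletonI, of v] by (auto simp: proj_zeros_def)
qed

lemma istopology_zariski:
  "istopology (\<lambda>U :: ('a::field ^ 'n::finite) set set.
     \<exists>F. (\<forall>f\<in>F. \<exists>d. homogeneous d f) \<and> U = proj_space - proj_zeros F)"
  (is "istopology ?open")
  unfolding istopology_def
proof (intro conjI allI impI)
  fix S T assume "?open S" and "?open T"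
  then obtain F G where F: "\<forall>f\<in>F. \<exists>d. homogeneous d f" "S = proj_space - proj_zeros F"
    and G: "\<forall>g\<in>G. \<exists>d. homogeneous d g" "T = proj_space - proj_zeros G"
    by blast
  define H where "H = (\<lambda>(f, g). f * g) ` (F \<times> G)"
  have H: "\<forall>h\<in>H. \<exists>d. homogeneous d h"
    using F(1) G(1) by (fastforce simp: H_def intro: homogeneous_mult)
  have "P \<in> proj_zeros H \<longleftrightarrow> P \<in> proj_zeros F \<or> P \<in> proj_zeros G"
    if "P \<in> proj_space" for P
  proof -
    obtain v where v: "v \<noteq> 0" "P = vec.span {v}"
      using \<open>P \<in> proj_space\<close> unfolding proj_space_def by blast
    show ?thesis
      unfolding v(2) in_proj_zeros_span_iff[OF v(1) F(1)] in_proj_zeros_span_iff[OF v(1) G(1)]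
        in_proj_zeros_span_iff[OF v(1) H]
      by (auto simp: H_def mpoly_eval_mult)
  qed
  then have "S \<inter> T = proj_space - proj_zeros H"
    using F(2) G(2) by blast
  with H show "?open (S \<inter> T)"
    by blast
next
  fix K assume "\<forall>S\<in>K. ?open S"
  then obtain F where F: "\<And>S. S \<in> K \<Longrightarrow>
      (\<forall>f\<in>F S. \<exists>d. homogeneous d f) \<and> S = proj_space - proj_zeros (F S)"
    by metis
  have "\<Union>K = (\<Union>S\<in>K. proj_space - proj_zeros (F S))"
    using F by auto
  also have "\<dots> = proj_space - proj_zeros (\<Union>S\<in>K. F S)"
    by (auto simp: proj_zeros_def)
  finally have "\<Union>K = proj_space - proj_zeros (\<Union>S\<in>K. F S)" .
  moreover have "\<forall>f\<in>(\<Union>S\<in>K. F S). \<exists>d. homogeneous d f"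
    using F by blast
  ultimately show "?open (\<Union>K)"
    by blast
qed

lemma openin_zariski_iff:
  "openin zariski U \<longleftrightarrow>
     (\<exists>F. (\<forall>f\<in>F. \<exists>d. homogeneous d f) \<and> U = proj_space - proj_zeros F)"
  unfolding zariski_def topology_inverse'[OF istopology_zariski] ..

lemma topspace_zariski [simp]:
  "topspace (zariski :: ('a::field ^ 'n::finite) set topology) = proj_space"
proof
  show "topspace zariski \<subseteq> (proj_space :: ('a ^ 'n) set set)"
    unfolding topspace_def openin_zariski_iff by blast
  have "homogeneous 0 (1 :: ('a, 'n) mpoly)"
    by (simp add: homogeneous_def)
  moreover have "mpoly_eval v 1 = 1" for v :: "'a ^ 'n"
    by (simp add: mpoly_eval_def)
  then have "proj_zeros {1 :: ('a, 'n) mpoly} = {}"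
    using vec.span_base[OF singletonI] by (fastforce simp: proj_zeros_def proj_space_def)
  ultimately have "openin zariski (proj_space :: ('a ^ 'n) set set)"
    unfolding openin_zariski_iff
    by (intro exI[of _ "{1 :: ('a, 'n) mpoly}"]) auto
  then show "(proj_space :: ('a ^ 'n) set set) \<subseteq> topspace zariski"
    by (rule openin_subset)
qed

lemma closedin_zariski_iff:
  fixes Z :: "('a::field ^ 'n::finite) set set"
  shows "closedin zariski Z \<longleftrightarrow> (\<exists>F. (\<forall>f\<in>F. \<exists>d. homogeneous d f) \<and> Z = proj_zeros F)"
proof -
  have sub: "proj_zeros F \<subseteq> proj_space" for F :: "('a, 'n) mpoly set"
    by (auto simp: proj_zeros_def)
  show ?thesis
    unfolding closedin_def openin_zariski_iff topspace_zariski
    using sub by (metis Diff_subset double_diff order_refl)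
qed

section \<open>Projective varieties\<close>

definition irreducible_space :: "'b topology \<Rightarrow> bool" where
  "irreducible_space T \<longleftrightarrow> topspace T \<noteq> {} \<and>
     (\<forall>A B. closedin T A \<and> closedin T B \<and> A \<union> B = topspace T \<longrightarrow>
        A = topspace T \<or> B = topspace T)"

text \<open>
  The supremum of the lengths of strictly increasing chains of irreducible closed subsets
  (with value \<open>0\<close> for the empty space).
\<close>

definition krull_dim :: "'b topology \<Rightarrow> enat" where
  "krull_dim T = Sup {enat k | k. \<exists>Z :: nat \<Rightarrow> 'b set.
     (\<forall>i\<le>k. closedin T (Z i) \<and> irreducible_space (subtopology T (Z i))) \<and>
     (\<forall>i<k. Z i \<subset> Z (Suc i))}"

definition irreducible_projective_variety :: "('a::field ^ 'n::finite) set set \<Rightarrow> bool" where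
  "irreducible_projective_variety X \<longleftrightarrow>
     closedin zariski X \<and> irreducible_space (subtopology zariski X)"

definition variety_dim :: "('a::field ^ 'n::finite) set set \<Rightarrow> enat" where
  "variety_dim X = krull_dim (subtopology zariski X)"

text \<open>The homogeneous elements of the ideal of \<open>X\<close>; they generate it.\<close>

definition vanishing_forms :: "('a::field ^ 'n::finite) set set \<Rightarrow> ('a, 'n) mpoly set" where
  "vanishing_forms X =
     {f. (\<exists>d. homogeneous d f) \<and> (\<forall>P\<in>X. \<forall>v\<in>P. mpoly_eval v f = 0)}"

text \<open>
  The linear subspace of \<open>'a ^ 'n\<close> whose projectivisation is the embedded projective tangent
  space of \<open>X\<close> at the point spanned by \<open>v\<close>.
\<close>

definition affine_tangent_space ::
    "('a::field ^ 'n::finite) set set \<Rightarrow> 'a ^ 'n \<Rightarrow> ('a ^ 'n) set" where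
  "affine_tangent_space X v =
     {w. \<forall>f\<in>vanishing_forms X. (\<Sum>i\<in>UNIV. mpoly_eval v (mpoly_pderiv i f) * w $ i) = 0}"

text \<open>
  The Jacobian criterion. It is meant for irreducible \<open>X\<close>, where the local dimension at every
  point is \<open>variety_dim X\<close>; the tangent space upstairs has one dimension more than the projective one.
\<close>

definition smooth_variety :: "('a::field ^ 'n::finite) set set \<Rightarrow> bool" where
  "smooth_variety X \<longleftrightarrow>
     (\<forall>P\<in>X. \<forall>v\<in>P. v \<noteq> 0 \<longrightarrow> enat (vec.dim (affine_tangent_space X v)) = variety_dim X + 1)"

definition hyperplane :: "('a::field ^ 'n::finite) set set \<Rightarrow> bool" where
  "hyperplane H \<longleftrightarrow> (\<exists>f. homogeneous 1 f \<and> f \<noteq> 0 \<and> H = proj_zeros {f})"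

definition hypersurface :: "('a::field ^ 'n::finite) set set \<Rightarrow> bool" where
  "hypersurface H \<longleftrightarrow> (\<exists>d f. d \<ge> 1 \<and> homogeneous d f \<and> f \<noteq> 0 \<and> H = proj_zeros {f})"

definition non_degenerate :: "('a::field ^ 'n::finite) set set \<Rightarrow> bool" where
  "non_degenerate X \<longleftrightarrow> (\<forall>H. hyperplane H \<longrightarrow> \<not> X \<subseteq> H)"

section \<open>Ranks and secant varieties\<close>

text \<open>
  A point \<open>P\<close> lies in the projective linear span of a set \<open>S\<close> of points iff the line \<open>P\<close> is
  contained in the vector subspace spanned by the lines in \<open>S\<close>. For non-degenerate \<open>X\<close> the minimum
  exists and is at most \<open>CARD('n)\<close>: see \<open>x_rank_le_card\<close> below.
\<close>

definition x_rank :: "('a::field ^ 'n::finite) set set \<Rightarrow> ('a ^ 'n) set \<Rightarrow> nat" where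
  "x_rank X P = (LEAST r. \<exists>S. S \<subseteq> X \<and> finite S \<and> card S = r \<and> P \<subseteq> vec.span (\<Union>S))"

definition secant_points :: "nat \<Rightarrow> ('a::field ^ 'n::finite) set set \<Rightarrow> ('a ^ 'n) set set" where
  "secant_points s X = {P \<in> proj_space. x_rank X P \<le> s}"

definition secant_variety :: "nat \<Rightarrow> ('a::field ^ 'n::finite) set set \<Rightarrow> ('a ^ 'n) set set" where
  "secant_variety s X = zariski closure_of secant_points s X"

definition generic_rank :: "('a::field ^ 'n::finite) set set \<Rightarrow> nat" where
  "generic_rank X = (LEAST s. s \<ge> 1 \<and> secant_variety s X = proj_space)"

definition max_rank_on ::
    "('a::field ^ 'n::finite) set set \<Rightarrow> ('a ^ 'n) set set \<Rightarrow> nat" where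
  "max_rank_on X Y = Max (x_rank X ` Y)"

lemma span_of_non_degenerate:
  fixes X :: "('a::field ^ 'n::finite) set set"
  assumes X: "X \<subseteq> proj_space" and nd: "non_degenerate X"
  shows "vec.span (\<Union>X) = UNIV"
proof (rule ccontr)
  assume "vec.span (\<Union>X) \<noteq> UNIV"
  then obtain u where u: "u \<notin> vec.span (\<Union>X)"
    by blast
  obtain B where B: "B \<subseteq> \<Union>X" "vec.independent B" "\<Union>X \<subseteq> vec.span B"
    using vec.maximal_independent_subset by metis
  have uB: "u \<notin> vec.span B"
    using u B(1) vec.span_mono by blast
  have "vec.independent (insert u B)"
    using uB B(2) vec.independent_insertI by blast
  then obtain g :: "'a ^ 'n \<Rightarrow> 'a ^ 'n" where g: "Vector_Spaces.linear (*s) (*s) g"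
    "\<forall>x\<in>insert u B. g x = (if x = u then 1 else 0)"
    using vec.linear_independent_extend[of "insert u B" "\<lambda>x. if x = u then 1 else 0"] by metis
  note hom_g = Vector_Spaces.linear.axioms(3)[OF g(1)]
  define i where "i = (undefined :: 'n)"
  define a where "a j = g (axis j 1) $ i" for j
  have a: "g w $ i = (\<Sum>j\<in>UNIV. a j * w $ j)" for w
  proof -
    have "g w = g (\<Sum>j\<in>UNIV. w $ j *s axis j 1)"
      unfolding basis_expansion ..
    also have "\<dots> = (\<Sum>j\<in>UNIV. w $ j *s g (axis j 1))"
      unfolding module_hom.sum[OF hom_g] module_hom.scale[OF hom_g] ..
    finally show ?thesis
      by (simp add: a_def mult.commute)
  qed
  define f :: "('a, 'n) mpoly" where
    "f = (\<Sum>j\<in>UNIV. Poly_Mapping.single (Poly_Mapping.single j 1) (a j))"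
  have ev_sum: "mpoly_eval w (\<Sum>j\<in>A. h j) = (\<Sum>j\<in>A. mpoly_eval w (h j))"
    for w :: "'a ^ 'n" and h :: "'n \<Rightarrow> ('a, 'n) mpoly" and A :: "'n set"
    by (induction A rule: infinite_finite_induct) (simp_all add: mpoly_eval_add)
  have mon: "(\<Prod>k\<in>UNIV. (w $ k) ^ Poly_Mapping.lookup (Poly_Mapping.single j 1) k) = w $ j"
    for w :: "'a ^ 'n" and j :: 'n
  proof -
    have "(\<Prod>k\<in>UNIV. (w $ k) ^ Poly_Mapping.lookup (Poly_Mapping.single j 1) k)
        = (\<Prod>k\<in>UNIV. if j = k then w $ k else 1)"
      by (intro prod.cong) (auto simp: lookup_single when_def)
    then show ?thesis by simp
  qed
  have ev: "mpoly_eval w f = g w $ i" for w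
    by (simp only: f_def ev_sum mpoly_eval_single mon a)
  have hom: "homogeneous 1 f"
    unfolding homogeneous_def
  proof
    fix m assume m: "m \<in> Poly_Mapping.keys f"
    have "\<exists>j. m = Poly_Mapping.single j 1"
    proof (rule ccontr)
      assume "\<nexists>j. m = Poly_Mapping.single j 1"
      then have "Poly_Mapping.lookup f m = 0"
        unfolding f_def lookup_sum
        by (intro sum.neutral) (auto simp: lookup_single when_def)
      with m show False by (simp add: in_keys_iff)
    qed
    then obtain j where "m = Poly_Mapping.single j 1" ..
    then show "(\<Sum>i\<in>UNIV. Poly_Mapping.lookup m i) = 1"
      by (simp add: lookup_single when_def)
  qed
  have "f \<noteq> 0"
  proof
    assume "f = 0"
    then have "g u $ i = 0"
      using ev[of u] by simp
    moreover have "g u = 1"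
      using g(2) by simp
    ultimately show False by simp
  qed
  with hom have "hyperplane (proj_zeros {f})"
    by (auto simp: hyperplane_def)
  moreover have "X \<subseteq> proj_zeros {f}"
  proof -
    have "u \<notin> B"
      using uB vec.span_base by blast
    then have "g x = 0" if "x \<in> B" for x
      using g(2) that by auto
    then have "g w = 0" if "w \<in> vec.span B" for w
      using module_hom.eq_0_on_span[OF hom_g _ that] by blast
    then have "mpoly_eval w f = 0" if "w \<in> \<Union>X" for w
      using subsetD[OF B(3) that] unfolding ev by (metis zero_index)
    with X show ?thesis
      unfolding proj_zeros_def by blast
  qed
  ultimately show False
    using nd unfolding non_degenerate_def by blast
qed

lemma x_rank_le_card:
  fixes X :: "('a::field ^ 'n::finite) set set"
  assumes "X \<subseteq> proj_space" and "non_degenerate X"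
  shows "\<exists>S. S \<subseteq> X \<and> finite S \<and> card S = x_rank X P \<and> P \<subseteq> vec.span (\<Union>S)"
    and "x_rank X P \<le> CARD('n)"
proof -
  obtain B where B: "B \<subseteq> \<Union>X" "vec.independent B" "\<Union>X \<subseteq> vec.span B"
    using vec.maximal_independent_subset by metis
  have fin: "finite B"
    using B(2) by (rule vec.finiteI_independent)
  have "card B \<le> CARD('n)"
    using vec.independent_card_le_dim[OF subset_UNIV B(2)] unfolding vec_dim_card .
  have "\<forall>b\<in>B. \<exists>P. P \<in> X \<and> b \<in> P"
    using B(1) by blast
  then obtain L where L: "\<forall>b\<in>B. L b \<in> X \<and> b \<in> L b"
    by (rule bchoice[THEN exE])
  have "B \<subseteq> \<Union>(L ` B)"
    using L by blast
  then have "vec.span B \<subseteq> vec.span (\<Union>(L ` B))"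
    by (rule vec.span_mono)
  moreover have "UNIV \<subseteq> vec.span B"
    using vec.span_mono[OF B(3)] unfolding span_of_non_degenerate[OF assms] vec.span_span .
  ultimately have span: "P \<subseteq> vec.span (\<Union>(L ` B))"
    by blast
  have "L ` B \<subseteq> X"
    using L by blast
  define Q where "Q r \<longleftrightarrow> (\<exists>S. S \<subseteq> X \<and> finite S \<and> card S = r \<and> P \<subseteq> vec.span (\<Union>S))" for r
  have rank: "x_rank X P = (LEAST r. Q r)"
    unfolding x_rank_def Q_def ..
  have Q: "Q (card (L ` B))"
    unfolding Q_def
    using \<open>L ` B \<subseteq> X\<close> finite_imageI[OF fin] span by blast
  have "Q (x_rank X P)"
    unfolding rank using Q by (rule LeastI[of Q])
  then show "\<exists>S. S \<subseteq> X \<and> finite S \<and> card S = x_rank X P \<and> P \<subseteq> vec.span (\<Union>S)"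
    unfolding Q_def .
  have "x_rank X P \<le> card (L ` B)"
    unfolding rank using Q by (rule Least_le[of Q])
  also have "\<dots> \<le> card B"
    using fin by (rule card_image_le)
  also have "\<dots> \<le> CARD('n)"
    by fact
  finally show "x_rank X P \<le> CARD('n)" .
qed

end

theory Submission
  imports Defs
begin

text \<open>
  Let \<open>f = 0\<close> define \<open>\<sigma>\<^sub>g\<^sub>-\<^sub>1(X)\<close>, let \<open>d\<close> be the degree of \<open>f\<close>, and let \<open>v\<close> span a point \<open>P\<close>
  off this hypersurface. The derivative of \<open>f\<close> at \<open>v\<close> in direction \<open>w\<close> is linear in \<open>w\<close>, and it is
  nonzero at \<open>w = v\<close>, where it is \<open>d f(v)\<close> by Euler's identity. Since \<open>X\<close> spans the whole space,
  it is nonzero for some \<open>w\<close> on \<open>X\<close>. For this \<open>w\<close> the polynomial \<open>f(v + t w)\<close> in \<open>t\<close> is not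
  constant, so it has a root \<open>t\<close>. Hence \<open>P\<close> is on a line through a point of \<open>X\<close>
  and a point of the hypersurface, unless \<open>v + t w = 0\<close>, in which case \<open>P\<close> is on \<open>X\<close> itself.
\<close>

text \<open>The restriction of \<open>f\<close> to the line \<open>v + t *s w\<close>, built as a
  univariate polynomial in \<open>t\<close> so that derivative, degree and roots are
  available.\<close>

definition line_poly :: "('a::field, 'n::finite) mpoly \<Rightarrow> 'a ^ 'n \<Rightarrow> 'a ^ 'n \<Rightarrow> 'a poly" where
  "line_poly f v w =
     (\<Sum>m\<in>Poly_Mapping.keys f.
        smult (Poly_Mapping.lookup f m) (\<Prod>i\<in>UNIV. [:v $ i, w $ i:] ^ Poly_Mapping.lookup m i))"

lemma poly_line_poly: "poly (line_poly f v w) t = mpoly_eval (v + t *s w) f"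
  by (simp add: line_poly_def mpoly_eval_def poly_sum poly_prod)

text \<open>For \<open>k = 0\<close> the truncated exponent \<open>k - 1\<close> is harmless, since
  the factor \<open>of_nat k\<close> vanishes.\<close>

lemma pderiv_linear_power:
  fixes a b :: "'a::field_char_0"
  shows "poly (pderiv ([:a, b:] ^ k)) 0 = of_nat k * a ^ (k - 1) * b"
  by (cases k) (simp_all add: pderiv_power_Suc pderiv_pCons del: power_Suc)

lemma directional_derivative_linear:
  fixes f :: "('a::field_char_0, 'n::finite) mpoly"
  shows "\<exists>a. \<forall>w. poly (pderiv (line_poly f v w)) 0 = (\<Sum>i\<in>UNIV. a i * w $ i)"
proof -
  \<comment> \<open>The \<open>i\<close>-th partial derivative of \<open>f\<close> at
    \<open>v\<close>, in the shape produced by the product rule.\<close>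
  define a where "a i = (\<Sum>m\<in>Poly_Mapping.keys f. Poly_Mapping.lookup f m *
    ((\<Prod>j\<in>UNIV - {i}. (v $ j) ^ Poly_Mapping.lookup m j) *
     (of_nat (Poly_Mapping.lookup m i) * (v $ i) ^ (Poly_Mapping.lookup m i - 1))))" for i
  have monomial: "poly (pderiv (\<Prod>i\<in>UNIV. [:v $ i, w $ i:] ^ e i)) 0 =
      (\<Sum>i\<in>UNIV. (\<Prod>j\<in>UNIV - {i}. (v $ j) ^ e j) * (of_nat (e i) * (v $ i) ^ (e i - 1)) * w $ i)"
    for w and e :: "'n \<Rightarrow> nat"
    unfolding pderiv_prod poly_sum
    by (intro sum.cong refl) (simp only: poly_mult poly_prod poly_power pderiv_linear_power
        poly_pCons mult_zero_left add_0_right mult.assoc)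
  have "poly (pderiv (line_poly f v w)) 0 = (\<Sum>i\<in>UNIV. a i * w $ i)" for w
  proof -
    have "poly (pderiv (line_poly f v w)) 0 =
        (\<Sum>m\<in>Poly_Mapping.keys f. Poly_Mapping.lookup f m *
          poly (pderiv (\<Prod>i\<in>UNIV. [:v $ i, w $ i:] ^ Poly_Mapping.lookup m i)) 0)"
      by (simp add: line_poly_def higher_pderiv_sum[of 1, simplified] pderiv_smult poly_sum)
    also have "\<dots> = (\<Sum>i\<in>UNIV. a i * w $ i)"
      unfolding monomial a_def sum_distrib_left sum_distrib_right mult.assoc by (rule sum.swap)
    finally show ?thesis .
  qed
  then show ?thesis by blast
qed

text \<open>Along \<open>v + t *s v = (1 + t) *s v\<close>, homogeneity turns \<open>f\<close> into
  \<open>(1 + t) ^ d\<close> times its value at \<open>v\<close>.\<close>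

lemma euler_identity:
  fixes f :: "('a::field_char_0, 'n::finite) mpoly"
  assumes "homogeneous d f"
  shows "poly (pderiv (line_poly f v v)) 0 = of_nat d * mpoly_eval v f"
proof -
  have "poly (line_poly f v v) t = poly (smult (mpoly_eval v f) ([:1, 1:] ^ d)) t" for t
  proof -
    have scale: "v + t *s v = (1 + t) *s v"
      by (simp add: vec_eq_iff algebra_simps)
    show ?thesis
      unfolding poly_line_poly scale mpoly_eval_scale[OF assms] by (simp add: mult.commute)
  qed
  \<comment> \<open>Agreement at every \<open>t\<close> gives equal polynomials because the field is
    infinite.\<close>
  then have "line_poly f v v = smult (mpoly_eval v f) ([:1, 1:] ^ d)"
    by (simp add: poly_eq_poly_eq_iff[symmetric] fun_eq_iff)
  then show ?thesis
    by (simp add: pderiv_smult pderiv_linear_power)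
qed

lemma exists_point_on_secant_line:
  fixes f :: "('a::{alg_closed_field, field_char_0}, 'n::finite) mpoly"
  assumes "vec.span S = UNIV" and hom: "homogeneous d f" and "d \<ge> 1" and "mpoly_eval v f \<noteq> 0"
  shows "\<exists>w\<in>S. \<exists>t. mpoly_eval (v + t *s w) f = 0"
proof -
  obtain a where a: "\<And>w. poly (pderiv (line_poly f v w)) 0 = (\<Sum>i\<in>UNIV. a i * w $ i)"
    using directional_derivative_linear by blast
  \<comment> \<open>A linear form vanishing on \<open>S\<close> vanishes on its span, hence at
    \<open>v\<close>, against Euler's identity: \<open>of_nat d\<close> is nonzero in characteristic
    0.\<close>
  have "\<exists>w\<in>S. (\<Sum>i\<in>UNIV. a i * w $ i) \<noteq> 0"
  proof (rule ccontr)
    assume "\<not> ?thesis"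
    then have "S \<subseteq> {w. (\<Sum>i\<in>UNIV. a i * w $ i) = 0}"
      by blast
    moreover have "vec.subspace {w. (\<Sum>i\<in>UNIV. a i * w $ i) = 0}"
      by (auto simp: vec.subspace_def distrib_left sum.distrib mult.left_commute
          simp flip: sum_distrib_left)
    ultimately have "v \<in> {w. (\<Sum>i\<in>UNIV. a i * w $ i) = 0}"
      using vec.span_minimal assms(1) by blast
    then show False
      using euler_identity[OF hom, of v] assms(3,4) by (simp add: a)
  qed
  then obtain w where w: "w \<in> S" "poly (pderiv (line_poly f v w)) 0 \<noteq> 0"
    by (auto simp: a)
  then have "degree (line_poly f v w) > 0"
    by (metis gr0I pderiv_eq_0_iff poly_0)
  then obtain t where "poly (line_poly f v w) t = 0"
    using alg_closed_imp_poly_has_root by blast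
  with w(1) show ?thesis
    unfolding poly_line_poly by blast
qed

lemma x_rank_le:
  assumes "S \<subseteq> X" and "finite S" and "P \<subseteq> vec.span (\<Union>S)"
  shows "x_rank X P \<le> card S"
  unfolding x_rank_def using assms by (intro Least_le) blast

lemma x_rank_le_Suc:
  fixes X :: "('a::field ^ 'n::finite) set set"
  assumes X: "X \<subseteq> proj_space" "non_degenerate X"
    and "L \<in> X" "w \<in> L" and "v \<in> vec.span (insert w R)"
  shows "x_rank X (vec.span {v}) \<le> x_rank X R + 1"
proof -
  obtain S where S: "S \<subseteq> X" "finite S" "card S = x_rank X R" "R \<subseteq> vec.span (\<Union>S)"
    using x_rank_le_card(1)[OF X] by blast
  have "R \<subseteq> vec.span (\<Union>(insert L S))"
    using S(4) vec.span_mono[of "\<Union>S" "\<Union>(insert L S)"] by auto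
  then have "insert w R \<subseteq> vec.span (\<Union>(insert L S))"
    using assms(3,4) vec.span_base[of w "\<Union>(insert L S)"] by blast
  then have "v \<in> vec.span (\<Union>(insert L S))"
    using assms(5) vec.span_minimal[OF _ vec.subspace_span] by blast
  then have "vec.span {v} \<subseteq> vec.span (\<Union>(insert L S))"
    by (intro vec.span_minimal vec.subspace_span) auto
  then have "x_rank X (vec.span {v}) \<le> card (insert L S)"
    using S(1,2) assms(3) by (intro x_rank_le) auto
  \<comment> \<open>Only an inequality, as \<open>L\<close> may already lie in
    \<open>S\<close>.\<close>
  also have "\<dots> \<le> x_rank X R + 1"
    using S(2,3) by (simp add: card_insert_if)
  finally show ?thesis .
qed

theorem theorem1p2:
  fixes X :: "('a::{alg_closed_field, field_char_0} ^ 'n::finite) set set"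
    and n g N :: nat
  assumes "CARD('n) = N + 1"
    and "irreducible_projective_variety X"
    and "smooth_variety X"
    and "non_degenerate X"
    and "variety_dim X = enat n"
    and "g = generic_rank X"
    and "g > 2"
    and "hypersurface (secant_variety (g - 1) X)"
  shows "max_rank_on X proj_space \<le> max_rank_on X (secant_variety (g - 1) X) + 1"
proof -
  define Y where "Y = secant_variety (g - 1) X"
  have X: "X \<subseteq> proj_space"
    using assms(2) closedin_subset[of zariski X]
    unfolding irreducible_projective_variety_def by simp
  obtain d f where f: "d \<ge> 1" "homogeneous d f" "Y = proj_zeros {f}"
    using assms(8) unfolding hypersurface_def Y_def by blast
  \<comment> \<open>The uniform bound on ranks makes each \<open>Max\<close> a genuine
    maximum.\<close>
  have fin: "finite (x_rank X ` Z)" for Z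
    by (rule finite_subset[of _ "{..CARD('n)}"]) (use x_rank_le_card(2)[OF X assms(4)] in auto)
  have le: "x_rank X R \<le> max_rank_on X Y" if "R \<in> Y" for R
    unfolding max_rank_on_def using that fin by (intro Max_ge) auto
  have Y: "vec.span {u} \<in> Y \<longleftrightarrow> mpoly_eval u f = 0" if "u \<noteq> 0" for u
    unfolding f(3) using in_proj_zeros_span_iff[OF that, of "{f}"] f(2) by blast
  have "x_rank X P \<le> max_rank_on X Y + 1" if P: "P \<in> proj_space" for P
  proof -
    obtain v where v: "v \<noteq> 0" "P = vec.span {v}"
      using P unfolding proj_space_def by blast
    show ?thesis
    proof (cases "P \<in> Y")
      case True
      then show ?thesis using le[OF True] by simp
    next
      case False
      then have "mpoly_eval v f \<noteq> 0"
        using Y[OF v(1)] v(2) by simp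
      then obtain w t where w: "w \<in> \<Union>X" "mpoly_eval (v + t *s w) f = 0"
        using exists_point_on_secant_line[OF span_of_non_degenerate[OF X assms(4)] f(2,1), of v]
        by blast
      then obtain L where L: "L \<in> X" "w \<in> L"
        by blast
      define u where "u = v + t *s w"
      have v_eq: "v = u - t *s w"
        by (simp add: u_def)
      show ?thesis
      \<comment> \<open>The zero vector spans no projective point; in that case \<open>v\<close> is
        a multiple of \<open>w\<close>, so \<open>P\<close> has rank at most 1.\<close>
      proof (cases "u = 0")
        case True
        then have "v \<in> vec.span L"
          using L(2) unfolding v_eq by (simp add: vec.span_neg vec.span_scale vec.span_base)
        then have "P \<subseteq> vec.span (\<Union>{L})"
          unfolding v(2) by (intro vec.span_minimal vec.subspace_span) auto
        then have "x_rank X P \<le> card {L}"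
          using L(1) by (intro x_rank_le) auto
        then show ?thesis by simp
      next
        case False
        then have "vec.span {u} \<in> Y"
          using Y[of u] w(2) unfolding u_def[symmetric] by simp
        have "u \<in> vec.span {u}"
          by (simp add: vec.span_base)
        then have "v \<in> vec.span (insert w (vec.span {u}))"
          unfolding v_eq by (intro vec.span_diff vec.span_scale) (auto intro: vec.span_base)
        then have "x_rank X P \<le> x_rank X (vec.span {u}) + 1"
          unfolding v(2) by (rule x_rank_le_Suc[OF X assms(4) L])
        with le[OF \<open>vec.span {u} \<in> Y\<close>] show ?thesis by linarith
      qed
    qed
  qed
  \<comment> \<open>Bounding \<open>Max\<close> from above needs a nonempty set; the all-ones vector
    spans a point.\<close>
  moreover have "(proj_space :: ('a ^ 'n) set set) \<noteq> {}"
  proof -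
    have "(1 :: 'a ^ 'n) \<noteq> 0" by (simp add: vec_eq_iff)
    then show ?thesis unfolding proj_space_def by blast
  qed
  ultimately show ?thesis
    unfolding Y_def[symmetric] max_rank_on_def[of X proj_space]
    using fin by (subst Max_le_iff) auto
qed

end
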